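(* Let $1\leqslant r\leqslant k$ be integers. There exist constants $C,c>0$ depending only on $k$ such that the following holds. Let $\mathcal{H}$ be a $k$-uniform hypergraph on $[N]$ which is $(r-1)$-tuple-regular and has maximum $r$-degree $\Delta_r$, and let $1\leqslant m\leqslant N$. Then for all $a>0$, \[ \mathbb{P}\big(|D^{\mathcal{H}}(B_m)|>a\big)\;\leqslant\; N^{C}\exp\left(\frac{-c\, a^{2/r}}{m\,\Delta_r^{2/r}}\right). \]
   Context: A $k$-uniform hypergraph $\mathcal{H}$ on $[N]=\{1,\dots,N\}$ is a set of $k$-element subsets (edges) of $[N]$; $e(\mathcal{H})$ is its number of edges. For $S\subseteq[N]$ let $d(S)$ be the number of edges containing $S$. The maximum $r$-degree $\Delta_r$ is the maximum of $d(S)$ over all $r$-element sets $S$. $\mathcal{H}$ is $r$-tuple-regular if all $r$-element subsets of $[N]$ have the same degree $d(S)$ (every hypergraph is $0$-tuple-regular). $B_m$ denotes a uniformly random $m$-element subset of $[N]$. $N^{\mathcal{H}}(B)=e(\mathcal{H}[B])$ is the number of edges of $\mathcal{H}$ contained in $B$, $L^{\mathcal{H}}(m)=\mathbb{E}[N^{\mathcal{H}}(B_m)]$, and $D^{\mathcal{H}}(B_m)=N^{\mathcal{H}}(B_m)-L^{\mathcal{H}}(m)$. *)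

theory Defs
  imports "HOL-Probability.Probability" "HOL-Library.Ramsey"
begin

definition uniform_hypergraph :: "nat \<Rightarrow> nat \<Rightarrow> nat set set \<Rightarrow> bool" where
  "uniform_hypergraph k N H \<longleftrightarrow> H \<subseteq> nsets {1..N} k"

definition set_degree :: "nat set set \<Rightarrow> nat set \<Rightarrow> nat" where
  "set_degree H S = card {e \<in> H. S \<subseteq> e}"

text \<open>Inserting 0 only matters when \<open>r > N\<close>: then there are no \<open>r\<close>-element sets and the maximum is 0.\<close>

definition max_degree :: "nat \<Rightarrow> nat \<Rightarrow> nat set set \<Rightarrow> nat" where
  "max_degree r N H = Max (insert 0 (set_degree H ` nsets {1..N} r))"

definition tuple_regular :: "nat \<Rightarrow> nat \<Rightarrow> nat set set \<Rightarrow> bool" where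
  "tuple_regular r N H \<longleftrightarrow>
     (\<forall>S \<in> nsets {1..N} r. \<forall>T \<in> nsets {1..N} r. set_degree H S = set_degree H T)"

definition random_subset :: "nat \<Rightarrow> nat \<Rightarrow> nat set pmf" where
  "random_subset N m = pmf_of_set (nsets {1..N} m)"

definition edge_count :: "nat set set \<Rightarrow> nat set \<Rightarrow> nat" where
  "edge_count H B = card {e \<in> H. e \<subseteq> B}"

definition mean_edge_count :: "nat \<Rightarrow> nat set set \<Rightarrow> nat \<Rightarrow> real" where
  "mean_edge_count N H m =
     measure_pmf.expectation (random_subset N m) (\<lambda>B. real (edge_count H B))"

definition edge_deviation :: "nat \<Rightarrow> nat set set \<Rightarrow> nat \<Rightarrow> nat set \<Rightarrow> real" where
  "edge_deviation N H m B = real (edge_count H B) - mean_edge_count N H m"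

end

theory Submission imports Defs begin

text \<open>
  All even moments of the deviation are bounded, and the tail follows from Markov's inequality with
  the optimal moment. Let \<open>f\<close> be a function of the random \<open>m\<close>-set \<open>B\<close> and add the elements of \<open>B\<close> one at
  a time; the conditional expectations of \<open>f\<close> form a martingale. The pointwise inequality
  \<open>(x + y)\<^sup>2\<^sup>p \<le> 2 p x\<^sup>2\<^sup>p\<^sup>-\<^sup>1 y + (x\<^sup>2 + 8 p y\<^sup>2)\<^sup>p\<close> loses its linear term on averaging over a martingale
  increment \<open>y\<close>, so the squared \<open>2p\<close>-norm grows by at most \<open>8 p\<close> times that of the increment in each of
  the \<open>m\<close> steps. By Jensen's inequality the \<open>2p\<close>-th moment of every increment is at most that of
  \<open>f(A \<union> {v}) - f(A \<union> {w})\<close> for a random \<open>(m - 1)\<close>-set \<open>A\<close> and random \<open>v, w \<notin> A\<close>.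

  If \<open>f\<close> counts edges, this difference is the difference of the edge counts in \<open>A\<close> of the links of \<open>v\<close> and
  \<open>w\<close>. For \<open>r = 1\<close> it is at most the maximum degree. For \<open>r \<ge> 2\<close> both links have the same expected
  count, are \<open>(r - 2)\<close>-tuple-regular and have the same bound on their \<open>(r - 1)\<close>-degrees, so induction on
  \<open>r\<close> bounds the \<open>2p\<close>-th moment of the deviation by \<open>(32 p m)\<^sup>r\<^sup>p \<Delta>\<^sup>2\<^sup>p\<close>, without any factor \<open>N\<^sup>C\<close>.
\<close>

section \<open>Power inequalities\<close>

lemma convex_on_power_nonneg: "convex_on {0..} (\<lambda>x::real. x ^ n)"
proof (cases "even n")
  case True
  then show ?thesis
    using convex_power_even convex_on_subset by (metis convex_real_interval(1) subset_UNIV)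
next
  case False
  then show ?thesis using convex_power_odd by blast
qed

text \<open>Convexity of \<open>t ^ p\<close> at \<open>u / s\<close> and \<open>z\<close> with
  weights \<open>s / (s + 1)\<close> and \<open>1 / (s + 1)\<close>. For \<open>s = 1\<close> this
  is midpoint convexity; for \<open>s = m\<close> it combines bounds of order \<open>m ^ p\<close>
  and \<open>1\<close> into one of order \<open>(m + 1) ^ p\<close>.\<close>

lemma power_add_le_weighted:
  fixes u z :: real
  assumes "0 \<le> u" "0 \<le> z" "0 < s"
  shows "((u + z) / (s + 1)) ^ p \<le> (s * (u / s) ^ p + z ^ p) / (s + 1)"
proof -
  have eq: "(1 - 1 / (s + 1)) * (u / s) + (1 / (s + 1)) * z = (u + z) / (s + 1)"
    using assms by (simp add: divide_simps)
  have "((1 - 1 / (s + 1)) *\<^sub>R (u / s) + (1 / (s + 1)) *\<^sub>R z) ^ p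
      \<le> (1 - 1 / (s + 1)) * (u / s) ^ p + (1 / (s + 1)) * z ^ p"
    by (rule convex_onD[OF convex_on_power_nonneg]) (use assms in auto)
  also have "\<dots> = (s * (u / s) ^ p + z ^ p) / (s + 1)"
    using assms by (simp add: divide_simps)
  finally show ?thesis using eq by simp
qed

text \<open>Midpoint convexity at \<open>a\<close> and \<open>- b\<close>; the sign disappears
  because the exponent is even.\<close>

lemma even_power_diff_le:
  fixes a b :: real
  shows "(a - b) ^ (2 * p) \<le> 4 ^ p * ((a ^ (2 * p) + b ^ (2 * p)) / 2)"
proof -
  have "((1 - 1 / 2) *\<^sub>R a + (1 / 2) *\<^sub>R (- b)) ^ (2 * p) \<le> (1 - 1 / 2) * a ^ (2 * p) + (1 / 2) * (- b) ^ (2 * p)"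
    by (rule convex_onD[OF convex_power_even[of "2 * p"]]) auto
  moreover have mid: "(1 - 1 / 2) *\<^sub>R a + (1 / 2) *\<^sub>R (- b) = (a - b) / 2"
    by (simp add: field_simps)
  moreover have neg: "(- b) ^ (2 * p) = b ^ (2 * p)"
    by simp
  ultimately have "((a - b) / 2) ^ (2 * p) \<le> (a ^ (2 * p) + b ^ (2 * p)) / 2"
    unfolding mid neg by simp
  then have "4 ^ p * ((a - b) / 2) ^ (2 * p) \<le> 4 ^ p * ((a ^ (2 * p) + b ^ (2 * p)) / 2)"
    by (rule mult_left_mono) simp
  moreover have "4 ^ p * ((a - b) / 2) ^ (2 * p) = (a - b) ^ (2 * p)"
    by (simp add: power_mult power_divide)
  ultimately show ?thesis by simp
qed

text \<open>The left side is the even part in \<open>y\<close> of \<open>(x + y) ^ (2 * q)\<close>.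
  Its recursion in \<open>q\<close> involves the odd part, so a bound for \<open>x * y\<close> times
  the odd part is carried along. The coefficient \<open>b\<close> stays fixed during the
  induction.\<close>

lemma sum_even_powers_le:
  fixes x y b :: real
  assumes "real (4 * q) \<le> b"
  shows "((x + y) ^ (2 * q) + (x - y) ^ (2 * q)) / 2 \<le> (x\<^sup>2 + b * y\<^sup>2) ^ q"
proof -
  have "((x + y) ^ (2 * q) + (x - y) ^ (2 * q)) / 2 \<le> (x\<^sup>2 + b * y\<^sup>2) ^ q \<and>
     x * y * ((x + y) ^ (2 * q) - (x - y) ^ (2 * q)) / 2
           \<le> 2 * real q * (x * y)\<^sup>2 * (x\<^sup>2 + b * y\<^sup>2) ^ (q - 1)"
    using assms
  proof (induction q)
    case 0
    then show ?case by simp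
  next
    case (Suc q)
    define R where "R = x\<^sup>2 + b * y\<^sup>2"
    define S where "S = ((x + y) ^ (2 * q) + (x - y) ^ (2 * q)) / 2"
    define T where "T = ((x + y) ^ (2 * q) - (x - y) ^ (2 * q)) / 2"
    have b: "4 * real q + 4 \<le> b" using Suc.prems by simp
    have SR: "S \<le> R ^ q" and TR: "x * y * T \<le> 2 * real q * (x * y)\<^sup>2 * R ^ (q - 1)"
      using Suc.IH b by (auto simp: S_def T_def R_def)
    have S': "((x + y) ^ (2 * Suc q) + (x - y) ^ (2 * Suc q)) / 2 = S * (x\<^sup>2 + y\<^sup>2) + 2 * (x * y * T)"
      by (simp add: S_def T_def power2_eq_square algebra_simps add_divide_distrib diff_divide_distrib)
    have T': "x * y * ((x + y) ^ (2 * Suc q) - (x - y) ^ (2 * Suc q)) / 2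
        = (x * y * T) * (x\<^sup>2 + y\<^sup>2) + 2 * (x * y)\<^sup>2 * S"
      by (simp add: S_def T_def power2_eq_square algebra_simps add_divide_distrib diff_divide_distrib)
    have R0: "0 \<le> R" and R1: "x\<^sup>2 + y\<^sup>2 \<le> R"
      using b mult_right_mono[of 1 b "y\<^sup>2"] by (auto simp: R_def)
    have Rq: "real q * R ^ (q - 1) * R = real q * R ^ q"
      by (cases q) auto
    have "S * (x\<^sup>2 + y\<^sup>2) + 2 * (x * y * T)
        \<le> R ^ q * (x\<^sup>2 + y\<^sup>2) + 2 * (2 * real q * (x * y)\<^sup>2 * R ^ (q - 1))"
      using SR TR by (intro add_mono mult_right_mono mult_left_mono) auto
    also have "2 * (2 * real q * (x * y)\<^sup>2 * R ^ (q - 1)) = 4 * y\<^sup>2 * (x\<^sup>2 * (real q * R ^ (q - 1)))"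
      by (simp add: power_mult_distrib)
    also have "\<dots> \<le> 4 * y\<^sup>2 * (R * (real q * R ^ (q - 1)))"
      using R0 R1 by (intro mult_left_mono mult_right_mono) (auto intro: order_trans[OF _ R1])
    also have "\<dots> = (4 * real q) * (y\<^sup>2 * R ^ q)"
      using Rq by (auto simp: algebra_simps)
    \<comment> \<open>The available slack is
      \<open>R - (x\<^sup>2 + y\<^sup>2) = (b - 1) * y\<^sup>2\<close>, enough since
      \<open>4 * q + 4 \<le> b\<close>.\<close>
    also have "\<dots> \<le> (b - 1) * (y\<^sup>2 * R ^ q)"
      using R0 b by (intro mult_right_mono) auto
    finally have 1: "S * (x\<^sup>2 + y\<^sup>2) + 2 * (x * y * T) \<le> R ^ Suc q"
      by (simp add: R_def algebra_simps)
    have "(x * y * T) * (x\<^sup>2 + y\<^sup>2) \<le> (2 * real q * (x * y)\<^sup>2 * R ^ (q - 1)) * (x\<^sup>2 + y\<^sup>2)"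
      using TR by (intro mult_right_mono) auto
    also have "\<dots> \<le> (2 * real q * (x * y)\<^sup>2 * R ^ (q - 1)) * R"
      using R1 R0 by (intro mult_left_mono) auto
    also have "\<dots> = 2 * (x * y)\<^sup>2 * (real q * R ^ (q - 1) * R)"
      by (simp add: mult_ac)
    also have "\<dots> = 2 * real q * (x * y)\<^sup>2 * R ^ q"
      by (subst Rq) (simp add: mult_ac)
    finally have "(x * y * T) * (x\<^sup>2 + y\<^sup>2) \<le> 2 * real q * (x * y)\<^sup>2 * R ^ q" .
    moreover have "2 * (x * y)\<^sup>2 * S \<le> 2 * (x * y)\<^sup>2 * R ^ q"
      using SR by (intro mult_left_mono) auto
    ultimately have 2: "(x * y * T) * (x\<^sup>2 + y\<^sup>2) + 2 * (x * y)\<^sup>2 * S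
        \<le> 2 * real (Suc q) * (x * y)\<^sup>2 * R ^ (Suc q - 1)"
      by (simp add: algebra_simps)
    show ?case
      unfolding S' T' using 1 2 by (simp add: R_def)
  qed
  then show ?thesis by blast
qed

text \<open>Bernoulli's inequality bounds \<open>(x - y) ^ (2 * p)\<close> from below by its tangent
  at \<open>y = 0\<close>. Subtracting this from \<open>sum_even_powers_le\<close> leaves the linear
  term and \<open>2 * (x\<^sup>2 + w) ^ p - x ^ (2 * p)\<close>, where
  \<open>w = 4 * p * y\<^sup>2\<close>.\<close>

lemma power_add_le_linear_plus:
  fixes x y :: real
  shows "(x + y) ^ (2 * p) \<le> 2 * real p * x ^ (2 * p - 1) * y + (x\<^sup>2 + 8 * real p * y\<^sup>2) ^ p"
proof (cases "x = 0 \<or> p = 0")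
  case True
  have "y ^ (2 * p) \<le> (8 * real p * y\<^sup>2) ^ p"
  proof (cases "p = 0")
    case False
    then have "y\<^sup>2 \<le> 8 * real p * y\<^sup>2"
      using mult_right_mono[of 1 "8 * real p" "y\<^sup>2"] by simp
    then show ?thesis by (simp add: power_mult power_mono)
  qed simp
  then show ?thesis using True by (cases "p = 0") (auto simp: power_0_left)
next
  case False
  define w where "w = 4 * real p * y\<^sup>2"
  have pow: "x ^ (2 * p) = x * x ^ (2 * p - 1)"
    using False by (cases p) auto
  have "1 + real (2 * p) * (- y / x) \<le> (1 + - y / x) ^ (2 * p)"
    by (rule Bernoulli_inequality_even) simp
  then have "x ^ (2 * p) * (1 + real (2 * p) * (- y / x)) \<le> x ^ (2 * p) * (1 + - y / x) ^ (2 * p)"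
    by (intro mult_left_mono) auto
  also have "\<dots> = (x - y) ^ (2 * p)"
    using False by (simp flip: power_mult_distrib add: algebra_simps)
  also have "x ^ (2 * p) * (1 + real (2 * p) * (- y / x)) = x ^ (2 * p) - 2 * real p * x ^ (2 * p - 1) * y"
    using False pow by (simp add: field_simps)
  finally have tangent: "x ^ (2 * p) - 2 * real p * x ^ (2 * p - 1) * y \<le> (x - y) ^ (2 * p)" .
  have even: "(x + y) ^ (2 * p) + (x - y) ^ (2 * p) \<le> 2 * (x\<^sup>2 + w) ^ p"
    using sum_even_powers_le[of p "4 * real p" x y] by (simp add: w_def)
  \<comment> \<open>Midpoint convexity absorbs \<open>x ^ (2 * p)\<close> at the price of doubling
    the coefficient \<open>4 * p\<close> to \<open>8 * p\<close>.\<close>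
  have "((x\<^sup>2 + (x\<^sup>2 + 2 * w)) / 2) ^ p \<le> ((x\<^sup>2) ^ p + (x\<^sup>2 + 2 * w) ^ p) / 2"
    using power_add_le_weighted[of "x\<^sup>2" "x\<^sup>2 + 2 * w" 1 p] by (simp add: w_def)
  then have "2 * (x\<^sup>2 + w) ^ p \<le> x ^ (2 * p) + (x\<^sup>2 + 2 * w) ^ p"
    by (simp add: power_mult add_divide_distrib)
  with tangent even show ?thesis by (simp add: w_def mult.assoc)
qed

section \<open>Averages over finite sets\<close>

definition mean_over :: "'a set \<Rightarrow> ('a \<Rightarrow> real) \<Rightarrow> real" where
  "mean_over S f = (\<Sum>x\<in>S. f x) / card S"

lemma mean_over_mono: "(\<And>x. x \<in> S \<Longrightarrow> f x \<le> g x) \<Longrightarrow> mean_over S f \<le> mean_over S g"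
  by (simp add: mean_over_def divide_right_mono sum_mono)

lemma mean_over_cong: "(\<And>x. x \<in> S \<Longrightarrow> f x = g x) \<Longrightarrow> mean_over S f = mean_over S g"
  by (simp add: mean_over_def cong: sum.cong)

lemma mean_over_nonneg: "(\<And>x. x \<in> S \<Longrightarrow> 0 \<le> f x) \<Longrightarrow> 0 \<le> mean_over S f"
  by (simp add: mean_over_def sum_nonneg)

lemma mean_over_add: "mean_over S (\<lambda>x. f x + g x) = mean_over S f + mean_over S g"
  by (simp add: mean_over_def sum.distrib add_divide_distrib)

lemma mean_over_diff: "mean_over S (\<lambda>x. f x - g x) = mean_over S f - mean_over S g"
  by (simp add: mean_over_def sum_subtractf diff_divide_distrib)

lemma mean_over_cmult: "mean_over S (\<lambda>x. c * f x) = c * mean_over S f"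
  by (simp add: mean_over_def sum_distrib_left)

lemma mean_over_const: "finite S \<Longrightarrow> S \<noteq> {} \<Longrightarrow> mean_over S (\<lambda>x. c) = c"
  by (simp add: mean_over_def)

text \<open>The denominator may exceed the number of summands: the sum is then padded with zeros.\<close>

lemma even_power_sum_div_le:
  fixes f :: "'a \<Rightarrow> real"
  assumes "finite S" "card S \<le> n" "0 < p"
  shows "((\<Sum>x\<in>S. f x) / n) ^ (2 * p) \<le> (\<Sum>x\<in>S. f x ^ (2 * p)) / n"
proof (cases "S = {}")
  case False
  define s where "s = real (card S)"
  have s: "0 < s" "s \<le> n" using assms False by (auto simp: s_def card_gt_0_iff)
  have "(\<Sum>x\<in>S. (1 / s) *\<^sub>R f x) ^ (2 * p) \<le> (\<Sum>x\<in>S. (1 / s) * f x ^ (2 * p))"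
    by (rule convex_on_sum[where C = UNIV, OF _ _ convex_power_even]) (use assms s in \<open>auto simp: s_def\<close>)
  then have jensen: "((\<Sum>x\<in>S. f x) / s) ^ (2 * p) \<le> (\<Sum>x\<in>S. f x ^ (2 * p)) / s"
    by (simp flip: sum_divide_distrib)
  have sn: "(s / n) ^ (2 * p) \<le> s / n"
    using power_decreasing[of 1 "2 * p" "s / n"] s assms(3) by simp
  have "((\<Sum>x\<in>S. f x) / n) ^ (2 * p) = (s / n) ^ (2 * p) * ((\<Sum>x\<in>S. f x) / s) ^ (2 * p)"
    using s by (simp flip: power_mult_distrib)
  also have "\<dots> \<le> (s / n) * ((\<Sum>x\<in>S. f x ^ (2 * p)) / s)"
    using s by (intro mult_mono[OF sn jensen]) auto
  also have "\<dots> = (\<Sum>x\<in>S. f x ^ (2 * p)) / n"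
    using s by simp
  finally show ?thesis .
qed (use assms in \<open>simp add: power_0_left\<close>)

text \<open>The condition \<open>0 \<le> c\<close> covers an empty \<open>S\<close>, over which
  \<open>mean_over\<close> is 0.\<close>

lemma mean_over_le: "0 \<le> c \<Longrightarrow> (\<And>x. x \<in> S \<Longrightarrow> f x \<le> c) \<Longrightarrow> mean_over S f \<le> c"
  using sum_bounded_above[of S f c]
  by (cases "card S = 0") (auto simp: mean_over_def divide_le_eq mult.commute)

lemma even_power_mean_over_le:
  assumes "finite S" "0 < p"
  shows "mean_over S f ^ (2 * p) \<le> mean_over S (\<lambda>x. f x ^ (2 * p))"
  unfolding mean_over_def using even_power_sum_div_le[OF assms(1) order_refl assms(2)] .

section \<open>Double counting of pairs of an \<open>m\<close>-set and a point outside it\<close>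

lemma sum_nsets_insert:
  fixes g :: "'a set \<Rightarrow> 'a \<Rightarrow> real"
  assumes "finite V"
  shows "(\<Sum>A\<in>nsets V m. \<Sum>v\<in>V - A. g A v) = (\<Sum>B\<in>nsets V (Suc m). \<Sum>v\<in>B. g (B - {v}) v)"
proof -
  have fin: "finite (nsets V j)" for j using assms by (rule finite_imp_finite_nsets)
  have "(\<Sum>A\<in>nsets V m. \<Sum>v\<in>V - A. g A v) = (\<Sum>(A, v)\<in>(SIGMA A:nsets V m. V - A). g A v)"
    using fin assms by (subst sum.Sigma) auto
  also have "\<dots> = (\<Sum>(B, v)\<in>(SIGMA B:nsets V (Suc m). B). g (B - {v}) v)"
    by (rule sum.reindex_bij_witness[where i = "\<lambda>(B, v). (B - {v}, v)" and j = "\<lambda>(A, v). (insert v A, v)"])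
       (auto simp: nsets_def)
  also have "\<dots> = (\<Sum>B\<in>nsets V (Suc m). \<Sum>v\<in>B. g (B - {v}) v)"
    using fin by (subst sum.Sigma) (auto simp: nsets_def)
  finally show ?thesis .
qed

lemma sum_nsets_swap:
  fixes g :: "'a set \<Rightarrow> 'a \<Rightarrow> real"
  assumes "finite V"
  shows "(\<Sum>A\<in>nsets V m. \<Sum>v\<in>V - A. g A v) = (\<Sum>v\<in>V. \<Sum>A\<in>nsets (V - {v}) m. g A v)"
proof -
  have fin: "finite (nsets U j)" if "U \<subseteq> V" for j U
    using assms that by (meson finite_imp_finite_nsets finite_subset)
  have "(\<Sum>A\<in>nsets V m. \<Sum>v\<in>V - A. g A v) = (\<Sum>(A, v)\<in>(SIGMA A:nsets V m. V - A). g A v)"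
    using fin assms by (subst sum.Sigma) auto
  also have "\<dots> = (\<Sum>(v, A)\<in>(SIGMA v:V. nsets (V - {v}) m). g A v)"
    by (rule sum.reindex_bij_witness[where i = "\<lambda>(v, A). (A, v)" and j = "\<lambda>(A, v). (v, A)"])
       (auto simp: nsets_def)
  also have "\<dots> = (\<Sum>v\<in>V. \<Sum>A\<in>nsets (V - {v}) m. g A v)"
    using fin assms by (subst sum.Sigma) (auto simp: Diff_subset)
  finally show ?thesis .
qed

lemma card_nsets_Diff:
  assumes "finite V" "A \<in> nsets V m"
  shows "card (V - A) = card V - m"
  using assms by (auto simp: nsets_def card_Diff_subset)

lemma mean_nsets_pairs:
  assumes "finite V"
  shows "mean_over (nsets V m) (\<lambda>A. mean_over (V - A) (g A))
     = (\<Sum>A\<in>nsets V m. \<Sum>v\<in>V - A. g A v) / (real (card V choose m) * real (card V - m))"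
  using card_nsets_Diff[OF assms]
  by (simp add: mean_over_def sum_divide_distrib mult.commute cong: sum.cong)

text \<open>A uniform \<open>m\<close>-set plus a uniform point outside it is a uniform
  \<open>(m + 1)\<close>-set, because every \<open>B\<close> arises from exactly
  \<open>m + 1\<close> pairs.\<close>

lemma mean_nsets_Suc:
  assumes "finite V" "m < card V"
  shows "mean_over (nsets V (Suc m)) g = mean_over (nsets V m) (\<lambda>A. mean_over (V - A) (\<lambda>v. g (insert v A)))"
proof -
  have "(\<Sum>A\<in>nsets V m. \<Sum>v\<in>V - A. g (insert v A)) = (\<Sum>B\<in>nsets V (Suc m). \<Sum>v\<in>B. g (insert v (B - {v})))"
    using sum_nsets_insert[OF assms(1), where m = m and g = "\<lambda>A v. g (insert v A)"] .
  also have "\<dots> = (\<Sum>B\<in>nsets V (Suc m). real (Suc m) * g B)"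
    by (intro sum.cong refl) (auto simp: nsets_def insert_absorb)
  finally have "mean_over (nsets V m) (\<lambda>A. mean_over (V - A) (\<lambda>v. g (insert v A)))
      = real (Suc m) * (\<Sum>B\<in>nsets V (Suc m). g B) / (real (card V choose m) * real (card V - m))"
    using mean_nsets_pairs[OF assms(1), where g = "\<lambda>A v. g (insert v A)"] by (simp add: sum_distrib_left)
  moreover have "(card V choose m) * (card V - m) = Suc m * (card V choose Suc m)"
    using binomial_absorb_comp[of "card V" m] binomial_absorption[of m "card V"] by (simp add: mult.commute)
  then have "real (card V choose m) * real (card V - m) = real (Suc m) * real (card V choose Suc m)"
    by (metis of_nat_mult)
  ultimately show ?thesis by (simp add: mean_over_def)
qed

text \<open>The point may be drawn before the \<open>m\<close>-set without changing the law; this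
  allows the vertex of a link to be held fixed.\<close>

lemma mean_nsets_swap:
  assumes "finite V" "m < card V"
  shows "mean_over (nsets V m) (\<lambda>A. mean_over (V - A) (g A))
     = mean_over V (\<lambda>v. mean_over (nsets (V - {v}) m) (\<lambda>A. g A v))"
proof -
  have "real (card V choose m) * real (card V - m) = real (card V) * real ((card V - 1) choose m)"
    using binomial_absorb_comp[of "card V" m] by (simp flip: of_nat_mult add: mult.commute)
  then show ?thesis
    using assms(1) sum_nsets_swap[OF assms(1), where m = m and g = g] mean_nsets_pairs[OF assms(1), where m = m and g = g]
    by (simp add: mean_over_def sum_divide_distrib mult.commute cong: sum.cong)
qed

section \<open>A moment inequality on a slice of the Boolean lattice\<close>

text \<open>The conditional expectation of \<open>f\<close> given all points but the last; its
  iterates form the martingale.\<close>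

definition average_up :: "'a set \<Rightarrow> ('a set \<Rightarrow> real) \<Rightarrow> 'a set \<Rightarrow> real" where
  "average_up V f A = mean_over (V - A) (\<lambda>v. f (insert v A))"

text \<open>The points \<open>v\<close> and \<open>w\<close> are drawn independently, so they may
  coincide.\<close>

definition swap_energy :: "'a set \<Rightarrow> nat \<Rightarrow> nat \<Rightarrow> ('a set \<Rightarrow> real) \<Rightarrow> real" where
  "swap_energy V m p f = mean_over (nsets V m) (\<lambda>A. mean_over (V - A) (\<lambda>v. mean_over (V - A)
     (\<lambda>w. (f (insert v A) - f (insert w A)) ^ (2 * p))))"

lemma swap_energy_nonneg: "0 \<le> swap_energy V m p f"
  unfolding swap_energy_def by (intro mean_over_nonneg) auto

text \<open>For \<open>v \<noteq> w\<close> the common set \<open>A \<union> {v, w}\<close> cancels.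
  Fewer than \<open>card V - Suc m\<close> differences remain over that denominator, so the
  zero-padded form of Jensen's inequality applies.\<close>

lemma average_up_diff_power_le:
  assumes "finite V" "A \<in> nsets V m" "Suc m < card V" "v \<in> V - A" "w \<in> V - A" "0 < p"
  shows "(average_up V f (insert v A) - average_up V f (insert w A)) ^ (2 * p)
    \<le> (\<Sum>u\<in>V - A - {v, w}. (f (insert v (insert u A)) - f (insert w (insert u A))) ^ (2 * p))
        / real (card V - Suc m)"
proof (cases "v = w")
  case True
  then show ?thesis using assms(6) by (auto simp: sum_nonneg power_0_left)
next
  case False
  define n where "n = card V - Suc m"
  have fin: "finite (V - A)" using assms by auto
  have up: "average_up V f (insert x A) =
      (f (insert x (insert y A)) + (\<Sum>u\<in>V - A - {v, w}. f (insert x (insert u A)))) / real n"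
    if "{x, y} = {v, w}" for x y
  proof -
    have xy: "x \<noteq> y" "x \<in> V - A" "y \<in> V - A"
      using that False assms(4,5) by (auto simp: doubleton_eq_iff)
    have "insert x A \<in> nsets V (Suc m)"
      using xy assms(2) by (auto simp: nsets_def)
    then have "card (V - insert x A) = n"
      using card_nsets_Diff[OF assms(1)] n_def by blast
    moreover have "V - insert x A = insert y (V - A - {v, w})"
      using xy unfolding that[symmetric] by auto
    moreover have "y \<notin> V - A - {v, w}" using that by auto
    ultimately show ?thesis
      using fin by (simp add: average_up_def mean_over_def insert_commute)
  qed
  have "average_up V f (insert v A) - average_up V f (insert w A)
     = (\<Sum>u\<in>V - A - {v, w}. f (insert v (insert u A)) - f (insert w (insert u A))) / real n"
    using up[of v w] up[of w v]
    by (simp add: insert_commute sum_subtractf diff_divide_distrib add_divide_distrib)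
  moreover have "card (V - A - {v, w}) \<le> n"
  proof -
    have "card (V - A - {v, w}) \<le> card (V - A - {v})"
      by (intro card_mono) (use fin in auto)
    also have "\<dots> = n"
      using assms card_nsets_Diff[OF assms(1,2)] fin by (simp add: n_def)
    finally show ?thesis .
  qed
  ultimately show ?thesis
    using even_power_sum_div_le[of "V - A - {v, w}" n p] fin assms(6) by (simp add: n_def)
qed

lemma sum_pairs_remove_swap:
  fixes g :: "'a \<Rightarrow> 'a \<Rightarrow> 'a \<Rightarrow> real"
  assumes "finite X"
  shows "(\<Sum>v\<in>X. \<Sum>w\<in>X. \<Sum>u\<in>X - {v, w}. g u v w) = (\<Sum>u\<in>X. \<Sum>v\<in>X - {u}. \<Sum>w\<in>X - {u}. g u v w)"
proof -
  have "(\<Sum>v\<in>X. \<Sum>w\<in>X. \<Sum>u\<in>X - {v, w}. g u v w)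
      = (\<Sum>v\<in>X. \<Sum>w\<in>X. \<Sum>u\<in>X. if u \<noteq> v \<and> u \<noteq> w then g u v w else 0)"
    using assms by (intro sum.cong refl sum.mono_neutral_cong_left) auto
  also have "\<dots> = (\<Sum>u\<in>X. \<Sum>v\<in>X. \<Sum>w\<in>X. if u \<noteq> v \<and> u \<noteq> w then g u v w else 0)"
    by (subst sum.swap[of _ X X], subst sum.swap) (meson sum.swap sum.cong)
  also have "\<dots> = (\<Sum>u\<in>X. \<Sum>v\<in>X - {u}. \<Sum>w\<in>X. if u \<noteq> v \<and> u \<noteq> w then g u v w else 0)"
    using assms by (intro sum.cong refl sum.mono_neutral_right) auto
  also have "\<dots> = (\<Sum>u\<in>X. \<Sum>v\<in>X - {u}. \<Sum>w\<in>X - {u}. g u v w)"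
    using assms by (intro sum.cong refl sum.mono_neutral_cong_right) auto
  finally show ?thesis .
qed

text \<open>The extensions of \<open>A \<union> {v}\<close> by \<open>w\<close> and of \<open>A \<union> {w}\<close> by \<open>v\<close> coincide and cancel; all others are
  paired by exchanging \<open>v\<close> and \<open>w\<close>.\<close>

lemma swap_energy_average_up:
  assumes "finite V" "Suc m < card V" "0 < p"
  shows "swap_energy V m p (average_up V f) \<le> swap_energy V (Suc m) p f"
proof -
  define F where "F B v w = (f (insert v B) - f (insert w B)) ^ (2 * p)" for B v w
  define n where "n = card V - Suc m"
  have n: "0 < n" using assms by (simp add: n_def)
  have F0: "0 \<le> F B v w" for B v w by (simp add: F_def)
  have *: "mean_over (V - A) (\<lambda>v. mean_over (V - A) (\<lambda>w.
        (average_up V f (insert v A) - average_up V f (insert w A)) ^ (2 * p)))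
      \<le> mean_over (V - A) (\<lambda>u. mean_over (V - insert u A) (\<lambda>v. mean_over (V - insert u A) (F (insert u A) v)))"
    (is "?l \<le> ?r") if A: "A \<in> nsets V m" for A
  proof -
    have X: "finite (V - A)" "card (V - A) = Suc n"
      using assms(1,2) card_nsets_Diff[OF assms(1) A] by (auto simp: n_def)
    have card_Xu: "card (V - A - {u}) = n" if "u \<in> V - A" for u
      using X that by simp
    have Xu: "V - insert u A = V - A - {u}" for u by auto
    have "?l \<le> mean_over (V - A) (\<lambda>v. mean_over (V - A) (\<lambda>w. (\<Sum>u\<in>V - A - {v, w}. F (insert u A) v w) / real n))"
      unfolding F_def n_def
      by (intro mean_over_mono average_up_diff_power_le) (use assms A in auto)
    also have "\<dots> = (\<Sum>v\<in>V - A. \<Sum>w\<in>V - A. \<Sum>u\<in>V - A - {v, w}. F (insert u A) v w) / (real (Suc n) * real (Suc n) * real n)"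
      using X by (simp add: mean_over_def sum_divide_distrib mult_ac del: of_nat_Suc)
    also have "\<dots> = (\<Sum>u\<in>V - A. \<Sum>v\<in>V - A - {u}. \<Sum>w\<in>V - A - {u}. F (insert u A) v w) / (real (Suc n) * real (Suc n) * real n)"
      using X by (subst sum_pairs_remove_swap) auto
    \<comment> \<open>Here \<open>u\<close> ranges over \<open>Suc n\<close> points,
      \<open>v\<close> and \<open>w\<close> over \<open>n\<close> each. Lowering one factor
      \<open>Suc n\<close> to \<open>n\<close> makes the denominator match and can only increase the
      quotient.\<close>
    also have "\<dots> \<le> (\<Sum>u\<in>V - A. \<Sum>v\<in>V - A - {u}. \<Sum>w\<in>V - A - {u}. F (insert u A) v w) / (real (Suc n) * real n * real n)"
      using n by (intro divide_left_mono sum_nonneg F0) (auto intro!: mult_mono)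
    also have "\<dots> = mean_over (V - A) (\<lambda>u. (\<Sum>v\<in>V - A - {u}. \<Sum>w\<in>V - A - {u}. F (insert u A) v w) / (real n * real n))"
      using X by (simp add: mean_over_def mult_ac del: of_nat_Suc flip: sum_divide_distrib)
    also have "\<dots> = ?r"
      using card_Xu by (intro mean_over_cong) (simp add: mean_over_def Xu sum_divide_distrib)
    finally show ?thesis .
  qed
  have "swap_energy V m p (average_up V f) \<le> mean_over (nsets V m) (\<lambda>A. mean_over (V - A)
      (\<lambda>u. mean_over (V - insert u A) (\<lambda>v. mean_over (V - insert u A) (F (insert u A) v))))"
    unfolding swap_energy_def by (rule mean_over_mono) (rule *)
  also have "\<dots> = swap_energy V (Suc m) p f"
    using assms by (subst mean_nsets_Suc[symmetric]) (auto simp: swap_energy_def F_def[abs_def])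
  finally show ?thesis .
qed

text \<open>One martingale step: \<open>f B - \<mu>\<close> splits into \<open>x A\<close>, known
  after \<open>m\<close> points, and an increment \<open>d A v\<close> of mean zero over
  \<open>v\<close>. The bound \<open>G\<close> controls the increment and also scales the moment at
  level \<open>m\<close>.\<close>

lemma slice_moment_step:
  fixes f :: "'a set \<Rightarrow> real"
  assumes "finite V" "m < card V" "0 < p"
    and G: "(8 * real p) ^ p * swap_energy V m p f \<le> G"
    and h: "mean_over (nsets V m) (\<lambda>A. (average_up V f A - \<mu>) ^ (2 * p)) \<le> real m ^ p * G"
  shows "mean_over (nsets V (Suc m)) (\<lambda>B. (f B - \<mu>) ^ (2 * p)) \<le> real (Suc m) ^ p * G"
proof -
  define h where "h = average_up V f"
  define x where "x A = h A - \<mu>" for A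
  define d where "d A v = f (insert v A) - h A" for A v
  define z where "z A v = 8 * real p * (d A v)\<^sup>2" for A v
  have fin: "finite (V - A)" for A using assms by auto
  have ne: "V - A \<noteq> {}" if "A \<in> nsets V m" for A
    using card_nsets_Diff[OF assms(1) that] assms(2) by force
  have d0: "mean_over (V - A) (d A) = 0" if "A \<in> nsets V m" for A
    using ne[OF that] fin by (simp add: d_def[abs_def] mean_over_diff mean_over_const h_def average_up_def)
  have "mean_over (nsets V m) (\<lambda>A. mean_over (V - A) (\<lambda>v. d A v ^ (2 * p))) \<le> swap_energy V m p f"
    unfolding swap_energy_def
  proof (intro mean_over_mono)
    fix A v assume A: "A \<in> nsets V m" "v \<in> V - A"
    have "d A v = mean_over (V - A) (\<lambda>w. f (insert v A) - f (insert w A))"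
      using ne[OF A(1)] fin by (simp add: d_def mean_over_diff mean_over_const h_def average_up_def)
    then show "d A v ^ (2 * p) \<le> mean_over (V - A) (\<lambda>w. (f (insert v A) - f (insert w A)) ^ (2 * p))"
      using even_power_mean_over_le[OF fin assms(3)] by simp
  qed
  then have "(8 * real p) ^ p * mean_over (nsets V m) (\<lambda>A. mean_over (V - A) (\<lambda>v. d A v ^ (2 * p)))
      \<le> (8 * real p) ^ p * swap_energy V m p f"
    by (intro mult_left_mono) auto
  then have "(8 * real p) ^ p * mean_over (nsets V m) (\<lambda>A. mean_over (V - A) (\<lambda>v. d A v ^ (2 * p))) \<le> G"
    using G by (rule order_trans)
  then have zG: "mean_over (nsets V m) (\<lambda>A. mean_over (V - A) (\<lambda>v. z A v ^ p)) \<le> G"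
    by (simp add: z_def power_mult_distrib mean_over_cmult flip: power_mult)
  have "mean_over (nsets V (Suc m)) (\<lambda>B. (f B - \<mu>) ^ (2 * p))
      = mean_over (nsets V m) (\<lambda>A. mean_over (V - A) (\<lambda>v. (x A + d A v) ^ (2 * p)))"
    using assms by (subst mean_nsets_Suc) (auto simp: x_def d_def)
  also have "\<dots> \<le> mean_over (nsets V m) (\<lambda>A. mean_over (V - A) (\<lambda>v. ((x A)\<^sup>2 + z A v) ^ p))"
  proof (rule mean_over_mono)
    fix A assume A: "A \<in> nsets V m"
    have "mean_over (V - A) (\<lambda>v. (x A + d A v) ^ (2 * p))
        \<le> mean_over (V - A) (\<lambda>v. (2 * real p * x A ^ (2 * p - 1)) * d A v + ((x A)\<^sup>2 + z A v) ^ p)"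
      unfolding z_def by (intro mean_over_mono power_add_le_linear_plus)
    then show "mean_over (V - A) (\<lambda>v. (x A + d A v) ^ (2 * p)) \<le> mean_over (V - A) (\<lambda>v. ((x A)\<^sup>2 + z A v) ^ p)"
      unfolding mean_over_add mean_over_cmult d0[OF A] by simp
  qed
  also have "\<dots> \<le> real (Suc m) ^ p * G"
  \<comment> \<open>The convexity weight \<open>m\<close> must be positive. For \<open>m = 0\<close>
    the assumed bound is \<open>0 ^ p * G = 0\<close>, which forces \<open>x {} = 0\<close>.\<close>
  proof (cases "m = 0")
    case True
    then have "x {} ^ (2 * p) \<le> 0"
      using h assms(3) by (simp add: x_def h_def mean_over_def power_0_left)
    then have "x {} = 0"
      using assms(3) by (metis dual_order.antisym even_mult_iff even_numeral power_eq_0_iff zero_le_even_power)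
    then show ?thesis
      using zG True by (simp add: mean_over_def)
  next
    case False
    \<comment> \<open>Convexity with weight \<open>m\<close>, scaled by \<open>(m + 1) ^ p\<close>.
      After averaging, the factor \<open>m ^ p\<close> of the assumed bound cancels and
      \<open>m * G + G\<close> remains.\<close>
    have "((x A)\<^sup>2 + z A v) ^ p \<le> real (Suc m) ^ p * (1 / real (Suc m)) * (real m / real m ^ p * x A ^ (2 * p) + z A v ^ p)" for A v
    proof -
      have "(((x A)\<^sup>2 + z A v) / (real m + 1)) ^ p \<le> (real m * ((x A)\<^sup>2 / real m) ^ p + z A v ^ p) / (real m + 1)"
        using False by (intro power_add_le_weighted) (auto simp: z_def)
      moreover have even: "x A ^ (2 * p) = ((x A)\<^sup>2) ^ p"
        by (rule power_mult)
      ultimately show ?thesis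
        unfolding even by (simp add: power_divide field_simps)
    qed
    then have "mean_over (nsets V m) (\<lambda>A. mean_over (V - A) (\<lambda>v. ((x A)\<^sup>2 + z A v) ^ p))
      \<le> mean_over (nsets V m) (\<lambda>A. mean_over (V - A) (\<lambda>v. real (Suc m) ^ p * (1 / real (Suc m)) *
           (real m / real m ^ p * x A ^ (2 * p) + z A v ^ p)))"
      by (intro mean_over_mono)
    also have "\<dots> = real (Suc m) ^ p * (1 / real (Suc m)) * (real m / real m ^ p *
        mean_over (nsets V m) (\<lambda>A. mean_over (V - A) (\<lambda>v. x A ^ (2 * p)))
         + mean_over (nsets V m) (\<lambda>A. mean_over (V - A) (\<lambda>v. z A v ^ p)))"
      by (simp only: mean_over_cmult mean_over_add)
    also have "mean_over (nsets V m) (\<lambda>A. mean_over (V - A) (\<lambda>v. x A ^ (2 * p)))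
        = mean_over (nsets V m) (\<lambda>A. x A ^ (2 * p))"
      using ne fin by (intro mean_over_cong mean_over_const) auto
    also have "real (Suc m) ^ p * (1 / real (Suc m)) * (real m / real m ^ p *
        mean_over (nsets V m) (\<lambda>A. x A ^ (2 * p))
         + mean_over (nsets V m) (\<lambda>A. mean_over (V - A) (\<lambda>v. z A v ^ p)))
       \<le> real (Suc m) ^ p * (1 / real (Suc m)) * (real m / real m ^ p * (real m ^ p * G) + G)"
      using h zG unfolding x_def h_def by (intro mult_left_mono add_mono) auto
    also have "\<dots> = real (Suc m) ^ p * G"
    proof -
      have "real m / real m ^ p * (real m ^ p * G) + G = real (Suc m) * G"
        using False by (simp add: field_simps)
      then show ?thesis by simp
    qed
    finally show ?thesis .
  qed
  finally show ?thesis .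
qed

text \<open>Removing the last point replaces \<open>f\<close> by \<open>average_up V f\<close>,
  which has the same mean and no larger energy, so the energy at the top level serves at every level
  below.\<close>

theorem slice_moment:
  fixes f :: "'a set \<Rightarrow> real"
  assumes "finite V" "m < card V" "0 < p"
  shows "mean_over (nsets V (Suc m)) (\<lambda>B. (f B - mean_over (nsets V (Suc m)) f) ^ (2 * p))
     \<le> (8 * real p * real (Suc m)) ^ p * swap_energy V m p f"
  using assms(2)
proof (induction m arbitrary: f)
  case 0
  have "mean_over (nsets V 0) (average_up V f) = mean_over (nsets V (Suc 0)) f"
    using mean_nsets_Suc[OF assms(1) 0, of f] by (simp add: average_up_def[abs_def])
  then have "mean_over (nsets V 0) (\<lambda>A. (average_up V f A - mean_over (nsets V (Suc 0)) f) ^ (2 * p)) = 0"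
    using assms(3) by (simp add: mean_over_def power_0_left)
  then show ?case
    using slice_moment_step[OF assms(1) 0 assms(3) order_refl] assms(3)
    by (simp add: power_0_left)
next
  case (Suc m)
  define \<mu> where "\<mu> = mean_over (nsets V (Suc (Suc m))) f"
  have \<mu>: "mean_over (nsets V (Suc m)) (average_up V f) = \<mu>"
    using mean_nsets_Suc[OF assms(1) Suc.prems, of f] by (simp add: average_up_def[abs_def] \<mu>_def)
  have "mean_over (nsets V (Suc m)) (\<lambda>B. (average_up V f B - \<mu>) ^ (2 * p))
      \<le> (8 * real p * real (Suc m)) ^ p * swap_energy V m p (average_up V f)"
    using Suc.IH[of "average_up V f"] Suc.prems \<mu> by simp
  also have "\<dots> \<le> (8 * real p * real (Suc m)) ^ p * swap_energy V (Suc m) p f"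
    using swap_energy_average_up[OF assms(1) Suc.prems assms(3)] by (intro mult_left_mono) auto
  finally have "mean_over (nsets V (Suc m)) (\<lambda>B. (average_up V f B - \<mu>) ^ (2 * p))
      \<le> real (Suc m) ^ p * ((8 * real p) ^ p * swap_energy V (Suc m) p f)"
    by (simp only: power_mult_distrib mult_ac)
  from slice_moment_step[OF assms(1) Suc.prems assms(3) order_refl this]
  show ?case by (simp only: \<mu>_def power_mult_distrib mult_ac)
qed

section \<open>Links of hypergraphs\<close>

definition link :: "nat set set \<Rightarrow> nat \<Rightarrow> nat set set" where
  "link H v = (\<lambda>e. e - {v}) ` {e \<in> H. v \<in> e}"

text \<open>This is \<open>tuple_regular\<close> over an arbitrary ground set, since the link of
  \<open>v\<close> lives on \<open>V - {v}\<close>.\<close>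

definition regular_on :: "nat set \<Rightarrow> nat \<Rightarrow> nat set set \<Rightarrow> bool" where
  "regular_on V s H \<longleftrightarrow> (\<forall>S\<in>nsets V s. \<forall>T\<in>nsets V s. set_degree H S = set_degree H T)"

lemma finite_hypergraph: "finite V \<Longrightarrow> H \<subseteq> nsets V k \<Longrightarrow> finite H"
  using finite_imp_finite_nsets finite_subset by metis

lemma link_subset_nsets: "H \<subseteq> nsets V k \<Longrightarrow> link H v \<subseteq> nsets (V - {v}) (k - 1)"
  by (auto simp: link_def nsets_def)

lemma inj_on_remove: "inj_on (\<lambda>e. e - {v}) {e \<in> H. v \<in> e}"
  by (auto simp: inj_on_def)

lemma set_degree_link:
  assumes "v \<notin> S"
  shows "set_degree (link H v) S = set_degree H (insert v S)"
proof -
  have "{e \<in> link H v. S \<subseteq> e} = (\<lambda>e. e - {v}) ` {e \<in> H. insert v S \<subseteq> e}"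
    using assms by (auto simp: link_def)
  moreover have "inj_on (\<lambda>e. e - {v}) {e \<in> H. insert v S \<subseteq> e}"
    by (rule inj_on_subset[OF inj_on_remove]) auto
  ultimately show ?thesis by (simp add: set_degree_def card_image)
qed

lemma card_link: "card (link H v) = set_degree H {v}"
  using set_degree_link[of v "{}" H] by (simp add: set_degree_def)

text \<open>Edges inside \<open>A \<union> {v}\<close> either avoid \<open>v\<close> or become link
  edges inside \<open>A\<close> when \<open>v\<close> is removed.\<close>

lemma edge_count_insert:
  assumes "finite H" "v \<notin> A"
  shows "edge_count H (insert v A) = edge_count H A + edge_count (link H v) A"
proof -
  let ?E = "{e \<in> H. v \<in> e \<and> e \<subseteq> insert v A}"
  have "{e \<in> link H v. e \<subseteq> A} = (\<lambda>e. e - {v}) ` ?E"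
    by (auto simp: link_def)
  moreover have "inj_on (\<lambda>e. e - {v}) ?E"
    by (rule inj_on_subset[OF inj_on_remove]) auto
  ultimately have "edge_count (link H v) A = card ?E"
    by (simp add: edge_count_def card_image)
  moreover have "{e \<in> H. e \<subseteq> insert v A} = {e \<in> H. e \<subseteq> A} \<union> ?E"
    by auto
  moreover have "{e \<in> H. e \<subseteq> A} \<inter> ?E = {}"
    using assms(2) by auto
  ultimately show ?thesis
    using assms(1) by (simp add: edge_count_def card_Un_disjoint)
qed

lemma edge_count_le_card: "finite H \<Longrightarrow> edge_count H A \<le> card H"
  by (auto simp: edge_count_def intro: card_mono)

lemma not_mem_if_in_nsets_Diff: "S \<in> nsets (V - {v}) s \<Longrightarrow> v \<notin> S"
  by (auto simp: nsets_def)

lemma insert_in_nsets: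
  assumes "S \<in> nsets (V - {v}) s" "v \<in> V"
  shows "insert v S \<in> nsets V (Suc s)"
proof -
  have "v \<notin> S" using assms(1) by (rule not_mem_if_in_nsets_Diff)
  then show ?thesis using assms by (auto simp: nsets_def)
qed

lemma regular_on_link:
  assumes "regular_on V (Suc s) H" "v \<in> V"
  shows "regular_on (V - {v}) s (link H v)"
  unfolding regular_on_def
proof (intro ballI)
  fix S T assume ST: "S \<in> nsets (V - {v}) s" "T \<in> nsets (V - {v}) s"
  then have "insert v S \<in> nsets V (Suc s)" "insert v T \<in> nsets V (Suc s)" "v \<notin> S" "v \<notin> T"
    using insert_in_nsets[OF ST(1) assms(2)] insert_in_nsets[OF ST(2) assms(2)]
      not_mem_if_in_nsets_Diff[OF ST(1)] not_mem_if_in_nsets_Diff[OF ST(2)] by simp_all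
  then show "set_degree (link H v) S = set_degree (link H v) T"
    using assms(1) unfolding regular_on_def by (metis set_degree_link)
qed

section \<open>Double counting of edges against the sets they contain or lie in\<close>

lemma card_nsets_superset:
  assumes "finite U" "e \<subseteq> U" "card e \<le> j"
  shows "card {S \<in> nsets U j. e \<subseteq> S} = (card U - card e) choose (j - card e)"
proof -
  have fe: "finite e" using assms finite_subset by blast
  have "bij_betw (\<lambda>S. S - e) {S \<in> nsets U j. e \<subseteq> S} (nsets (U - e) (j - card e))"
  proof (rule bij_betw_byWitness[where f' = "\<lambda>S. S \<union> e"])
    show "(\<lambda>S. S \<union> e) ` nsets (U - e) (j - card e) \<subseteq> {S \<in> nsets U j. e \<subseteq> S}"
    proof (clarsimp simp: nsets_def fe assms(2), intro conjI)
      fix S assume S: "S \<subseteq> U - e" "finite S" "card S = j - card e"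
      then have "S \<inter> e = {}" by auto
      with S fe assms(3) show "card (S \<union> e) = j" by (simp add: card_Un_disjoint)
    qed auto
  qed (use fe in \<open>auto simp: nsets_def card_Diff_subset\<close>)
  then show ?thesis
    using fe assms by (simp add: bij_betw_same_card card_Diff_subset)
qed

text \<open>Every edge lies in equally many \<open>j\<close>-sets, so only cardinalities matter.
  There are two ground sets because the links of two vertices live on different sets.\<close>

lemma mean_edge_count_cong:
  assumes "finite U" "finite U'" "card U = card U'"
    and "G \<subseteq> nsets U l" "G' \<subseteq> nsets U' l" "card G = card G'"
  shows "mean_over (nsets U j) (\<lambda>A. real (edge_count G A)) = mean_over (nsets U' j) (\<lambda>A. real (edge_count G' A))"
proof -
  \<comment> \<open>For \<open>l > j\<close> truncated subtraction would turn the binomial into 1,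
    although no \<open>j\<close>-set contains an edge.\<close>
  have *: "(\<Sum>A\<in>nsets X j. edge_count K A) = card K * (if l \<le> j then (card X - l) choose (j - l) else 0)"
    if X: "finite X" "K \<subseteq> nsets X l" for X K
  proof -
    have fin: "finite K" "finite (nsets X j)"
      using X finite_hypergraph finite_imp_finite_nsets by auto
    have "(\<Sum>A\<in>nsets X j. edge_count K A) = (\<Sum>e\<in>K. card {A \<in> nsets X j. e \<subseteq> A})"
      unfolding edge_count_def using fin(2,1) by (rule sum_multicount_gen) simp
    also have "\<dots> = (\<Sum>e\<in>K. if l \<le> j then (card X - l) choose (j - l) else 0)"
    proof (rule sum.cong[OF refl])
      fix e assume "e \<in> K"
      then have e: "e \<subseteq> X" "card e = l" using X by (auto simp: nsets_def)
      show "card {A \<in> nsets X j. e \<subseteq> A} = (if l \<le> j then (card X - l) choose (j - l) else 0)"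
      proof (cases "l \<le> j")
        case False
        then have "{A \<in> nsets X j. e \<subseteq> A} = {}"
          using e card_mono by (fastforce simp: nsets_def)
        then show ?thesis using False by (simp only: card.empty if_False)
      qed (use card_nsets_superset[of X e j] X e in simp)
    qed
    finally show ?thesis by simp
  qed
  show ?thesis
    using *[OF assms(1,4)] *[OF assms(2,5)] assms(3,6) by (simp add: mean_over_def flip: of_nat_sum)
qed

text \<open>For fixed \<open>x\<close>, the pairs of an \<open>(s + 1)\<close>-set \<open>S\<close>
  and an edge \<open>e\<close> with \<open>x \<in> S \<subseteq> e\<close> are counted in two ways.
  The factor \<open>(k - 1) choose s\<close> is positive and cancels.\<close>

lemma vertex_regular_if_regular_on:
  assumes "finite V" "H \<subseteq> nsets V k" "regular_on V (Suc s) H" "Suc s \<le> k" "v \<in> V" "w \<in> V"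
  shows "set_degree H {v} = set_degree H {w}"
proof (cases "H = {}")
  case False
  \<comment> \<open>An edge ensures \<open>Suc s \<le> card V\<close>, so a set \<open>S0\<close>
    carrying the common degree exists.\<close>
  then obtain e where "e \<in> H" by blast
  then have "e \<subseteq> V" "card e = k" using assms(2) by (auto simp: nsets_def)
  then have "Suc s \<le> card V" using assms(4) card_mono[OF assms(1), of e] by linarith
  then obtain S0 where S0: "S0 \<in> nsets V (Suc s)"
    using assms(1) nsets_eq_empty_iff[of V "Suc s"] by fastforce
  have *: "set_degree H {x} * ((k - 1) choose s) = ((card V - 1) choose s) * set_degree H S0" if "x \<in> V" for x
  proof -
    let ?N = "{S \<in> nsets V (Suc s). x \<in> S}"
    have fin: "finite {e \<in> H. x \<in> e}" "finite ?N"
      using finite_hypergraph[OF assms(1,2)] finite_imp_finite_nsets[OF assms(1)] by auto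
    have "(\<Sum>S\<in>?N. card {e \<in> {e \<in> H. x \<in> e}. S \<subseteq> e}) = (\<Sum>e\<in>{e \<in> H. x \<in> e}. card {S \<in> ?N. S \<subseteq> e})"
      using fin(2,1) by (rule sum_multicount_gen) simp
    also have "\<dots> = (\<Sum>e\<in>{e \<in> H. x \<in> e}. (k - 1) choose s)"
    proof (rule sum.cong[OF refl])
      fix e assume "e \<in> {e \<in> H. x \<in> e}"
      then have e: "e \<subseteq> V" "card e = k" "x \<in> e" "finite e" using assms(2) by (auto simp: nsets_def)
      then have "{S \<in> ?N. S \<subseteq> e} = {S \<in> nsets e (Suc s). {x} \<subseteq> S}"
        by (auto simp: nsets_def)
      then show "card {S \<in> ?N. S \<subseteq> e} = (k - 1) choose s"
        using card_nsets_superset[of e "{x}" "Suc s"] e by simp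
    qed
    also have "\<dots> = set_degree H {x} * ((k - 1) choose s)"
      by (simp add: set_degree_def)
    also have "(\<Sum>S\<in>?N. card {e \<in> {e \<in> H. x \<in> e}. S \<subseteq> e}) = (\<Sum>S\<in>?N. set_degree H S0)"
    proof (rule sum.cong[OF refl])
      fix S assume S: "S \<in> ?N"
      then have "{e \<in> {e \<in> H. x \<in> e}. S \<subseteq> e} = {e \<in> H. S \<subseteq> e}" by auto
      moreover have "set_degree H S = set_degree H S0"
        using S S0 assms(3) unfolding regular_on_def by blast
      ultimately show "card {e \<in> {e \<in> H. x \<in> e}. S \<subseteq> e} = set_degree H S0"
        by (simp only: set_degree_def)
    qed
    also have "\<dots> = ((card V - 1) choose s) * set_degree H S0"
      using card_nsets_superset[of V "{x}" "Suc s"] that assms(1) by simp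
    finally show ?thesis by simp
  qed
  have "set_degree H {v} * ((k - 1) choose s) = set_degree H {w} * ((k - 1) choose s)"
    using *[OF assms(5)] *[OF assms(6)] by simp
  then show ?thesis using assms(4) by auto
qed (simp add: set_degree_def)

section \<open>Moments of the edge count\<close>

lemma edge_count_swap_diff:
  assumes "finite H" "v \<notin> A" "w \<notin> A"
  shows "real (edge_count H (insert v A)) - real (edge_count H (insert w A))
       = real (edge_count (link H v) A) - real (edge_count (link H w) A)"
  using assms by (simp add: edge_count_insert)

text \<open>For the base of the induction: a link has as many edges as the degree of its vertex, so
  both link counts lie between 0 and \<Delta>.\<close>

lemma swap_energy_edge_count_le_degree:
  assumes "finite V" "H \<subseteq> nsets V k" "\<And>v. v \<in> V \<Longrightarrow> set_degree H {v} \<le> \<Delta>"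
  shows "swap_energy V m p (\<lambda>B. real (edge_count H B)) \<le> real \<Delta> ^ (2 * p)"
  unfolding swap_energy_def
proof (intro mean_over_le)
  fix A v w assume "A \<in> nsets V m" and vw: "v \<in> V - A" "w \<in> V - A"
  have finH: "finite H" by (rule finite_hypergraph[OF assms(1,2)])
  have le: "edge_count (link H x) A \<le> \<Delta>" if "x \<in> V" for x
  proof -
    have "edge_count (link H x) A \<le> card (link H x)"
      using finH by (intro edge_count_le_card) (simp add: link_def)
    then show ?thesis using assms(3)[OF that] by (simp add: card_link)
  qed
  have "\<bar>real (edge_count H (insert v A)) - real (edge_count H (insert w A))\<bar> \<le> real \<Delta>"
    using le[of v] le[of w] vw finH by (subst edge_count_swap_diff) auto
  then have "\<bar>real (edge_count H (insert v A)) - real (edge_count H (insert w A))\<bar> ^ (2 * p) \<le> real \<Delta> ^ (2 * p)"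
    by (intro power_mono) auto
  then show "(real (edge_count H (insert v A)) - real (edge_count H (insert w A))) ^ (2 * p) \<le> real \<Delta> ^ (2 * p)"
    by (simp add: power_even_abs)
qed auto

text \<open>All links have equally many edges, hence equal expected counts, which may be subtracted
  from both. Then \<open>even_power_diff_le\<close> separates the two deviations at the cost of
  \<open>4 ^ p\<close>.\<close>

lemma swap_energy_edge_count_le_links:
  assumes "finite V" "H \<subseteq> nsets V k" "m < card V"
    and deg: "\<And>v w. v \<in> V \<Longrightarrow> w \<in> V \<Longrightarrow> set_degree H {v} = set_degree H {w}"
    and "0 \<le> M"
    and M: "\<And>v. v \<in> V \<Longrightarrow> mean_over (nsets (V - {v}) m) (\<lambda>A. (real (edge_count (link H v) A)
        - mean_over (nsets (V - {v}) m) (\<lambda>A. real (edge_count (link H v) A))) ^ (2 * p)) \<le> M"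
  shows "swap_energy V m p (\<lambda>B. real (edge_count H B)) \<le> 4 ^ p * M"
proof -
  define L where "L v = mean_over (nsets (V - {v}) m) (\<lambda>A. real (edge_count (link H v) A))" for v
  define X where "X A v = (real (edge_count (link H v) A) - L v) ^ (2 * p)" for A v
  have finH: "finite H" by (rule finite_hypergraph[OF assms(1,2)])
  have L: "L v = L w" if "v \<in> V" "w \<in> V" for v w
    unfolding L_def
  proof (rule mean_edge_count_cong[where l = "k - 1"])
    show "card (link H v) = card (link H w)"
      unfolding card_link by (rule deg[OF that])
  qed (use assms(1) that link_subset_nsets[OF assms(2)] in auto)
  have ne: "V - A \<noteq> {}" "finite (V - A)" if "A \<in> nsets V m" for A
    using card_nsets_Diff[OF assms(1) that] assms(1,3) by (force, simp)
  have "swap_energy V m p (\<lambda>B. real (edge_count H B))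
      \<le> mean_over (nsets V m) (\<lambda>A. mean_over (V - A) (\<lambda>v. mean_over (V - A) (\<lambda>w. 4 ^ p * (1 / 2) * (X A v + X A w))))"
    unfolding swap_energy_def
  proof (intro mean_over_mono)
    fix A v w assume vw: "A \<in> nsets V m" "v \<in> V - A" "w \<in> V - A"
    have "real (edge_count H (insert v A)) - real (edge_count H (insert w A))
        = (real (edge_count (link H v) A) - L v) - (real (edge_count (link H w) A) - L w)"
      using vw finH L[of v w] by (subst edge_count_swap_diff) auto
    then show "(real (edge_count H (insert v A)) - real (edge_count H (insert w A))) ^ (2 * p)
        \<le> 4 ^ p * (1 / 2) * (X A v + X A w)"
      using even_power_diff_le[of "real (edge_count (link H v) A) - L v" "real (edge_count (link H w) A) - L w" p]
      by (simp add: X_def)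
  qed
  also have "\<dots> = mean_over (nsets V m) (\<lambda>A. 4 ^ p * mean_over (V - A) (X A))"
  proof (rule mean_over_cong)
    fix A assume A: "A \<in> nsets V m"
    show "mean_over (V - A) (\<lambda>v. mean_over (V - A) (\<lambda>w. 4 ^ p * (1 / 2) * (X A v + X A w)))
        = 4 ^ p * mean_over (V - A) (X A)"
      unfolding mean_over_cmult mean_over_add using ne[OF A] by (simp add: mean_over_const)
  qed
  also have "\<dots> = 4 ^ p * mean_over V (\<lambda>v. mean_over (nsets (V - {v}) m) (\<lambda>A. X A v))"
    using assms by (simp add: mean_over_cmult mean_nsets_swap)
  also have "\<dots> \<le> 4 ^ p * M"
    by (rule mult_left_mono, rule mean_over_le) (use M assms(5) in \<open>auto simp: X_def L_def\<close>)
  finally show ?thesis .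
qed

text \<open>Passing to links lowers \<open>r\<close>, \<open>k\<close> and \<open>m\<close> by one
  and keeps \<Delta>, so everything but \<Delta> and \<open>p\<close> varies in the induction. Each
  inductive step costs \<open>(8 * p * m) ^ p\<close> from \<open>slice_moment\<close> and
  \<open>4 ^ p\<close> from the links. The bounded degree has order \<open>Suc r\<close>, hence the
  exponent.\<close>

theorem edge_count_moment:
  assumes "finite V" "H \<subseteq> nsets V k" "r < k" "regular_on V r H"
    and "\<And>S. S \<in> nsets V (Suc r) \<Longrightarrow> set_degree H S \<le> \<Delta>"
    and "m \<le> card V" "0 < p"
  shows "mean_over (nsets V m) (\<lambda>B. (real (edge_count H B)
       - mean_over (nsets V m) (\<lambda>B. real (edge_count H B))) ^ (2 * p))
     \<le> (32 * real p * real m) ^ (p * Suc r) * real \<Delta> ^ (2 * p)"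
  using assms(1-6)
proof (induction r arbitrary: V H k m)
  case 0
  show ?case
  proof (cases m)
    case 0
    then show ?thesis using assms(7) by (simp add: mean_over_def power_0_left)
  next
    case (Suc m')
    have "mean_over (nsets V m) (\<lambda>B. (real (edge_count H B)
         - mean_over (nsets V m) (\<lambda>B. real (edge_count H B))) ^ (2 * p))
       \<le> (8 * real p * real m) ^ p * swap_energy V m' p (\<lambda>B. real (edge_count H B))"
      using slice_moment[OF 0(1) _ assms(7), of m'] Suc 0(6) by simp
    also have "\<dots> \<le> (32 * real p * real m) ^ p * real \<Delta> ^ (2 * p)"
      using 0(5) by (intro mult_mono power_mono swap_energy_edge_count_le_degree[OF 0(1,2)] swap_energy_nonneg)
        (auto simp: nsets_one)
    finally show ?thesis by simp
  qed
next
  case (Suc r)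
  show ?case
  proof (cases m)
    case 0
    then show ?thesis using assms(7) by (simp add: mean_over_def power_0_left)
  next
    case m: (Suc m')
    define M where "M = (32 * real p * real m) ^ (p * Suc r) * real \<Delta> ^ (2 * p)"
    have energy: "swap_energy V m' p (\<lambda>B. real (edge_count H B)) \<le> 4 ^ p * M"
    proof (rule swap_energy_edge_count_le_links[OF Suc.prems(1,2)])
      show "m' < card V" using m Suc.prems(6) by simp
      show "set_degree H {v} = set_degree H {w}" if "v \<in> V" "w \<in> V" for v w
        by (rule vertex_regular_if_regular_on[OF Suc.prems(1,2,4) _ that]) (use Suc.prems(3) in simp)
      show "0 \<le> M" by (simp add: M_def)
      fix v assume v: "v \<in> V"
      have "mean_over (nsets (V - {v}) m') (\<lambda>A. (real (edge_count (link H v) A)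
          - mean_over (nsets (V - {v}) m') (\<lambda>A. real (edge_count (link H v) A))) ^ (2 * p))
        \<le> (32 * real p * real m') ^ (p * Suc r) * real \<Delta> ^ (2 * p)"
      proof (rule Suc.IH[OF _ link_subset_nsets[OF Suc.prems(2)] _ regular_on_link[OF Suc.prems(4) v]])
        fix S assume S: "S \<in> nsets (V - {v}) (Suc r)"
        then have "insert v S \<in> nsets V (Suc (Suc r))" "v \<notin> S"
          using insert_in_nsets[OF S v] not_mem_if_in_nsets_Diff[OF S] by simp_all
        then show "set_degree (link H v) S \<le> \<Delta>"
          using Suc.prems(5) by (simp add: set_degree_link)
      qed (use Suc.prems m v in auto)
      also have "\<dots> \<le> M"
        unfolding M_def using m by (intro mult_right_mono power_mono mult_left_mono) auto
      finally show "mean_over (nsets (V - {v}) m') (\<lambda>A. (real (edge_count (link H v) A)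
          - mean_over (nsets (V - {v}) m') (\<lambda>A. real (edge_count (link H v) A))) ^ (2 * p)) \<le> M" .
    qed
    have "mean_over (nsets V m) (\<lambda>B. (real (edge_count H B)
         - mean_over (nsets V m) (\<lambda>B. real (edge_count H B))) ^ (2 * p))
       \<le> (8 * real p * real m) ^ p * swap_energy V m' p (\<lambda>B. real (edge_count H B))"
      using slice_moment[OF Suc.prems(1) _ assms(7), of m'] m Suc.prems(6) by simp
    also have "\<dots> \<le> (8 * real p * real m) ^ p * (4 ^ p * M)"
      by (intro mult_left_mono energy) auto
    also have "\<dots> = (32 * real p * real m) ^ p * M"
      by (simp add: mult_ac flip: power_mult_distrib)
    also have "\<dots> = (32 * real p * real m) ^ (p * Suc (Suc r)) * real \<Delta> ^ (2 * p)"
      by (simp add: M_def power_add)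
    finally show ?thesis .
  qed
qed

section \<open>Tail bounds\<close>

lemma prob_abs_gt_le_moment:
  assumes "finite S" "S \<noteq> {}" "0 < a"
  shows "measure_pmf.prob (pmf_of_set S) {x. \<bar>f x\<bar> > a} \<le> mean_over S (\<lambda>x. f x ^ (2 * p)) / a ^ (2 * p)"
proof -
  have "real (card (S \<inter> {x. \<bar>f x\<bar> > a})) * a ^ (2 * p) = (\<Sum>x\<in>S \<inter> {x. \<bar>f x\<bar> > a}. a ^ (2 * p))"
    by simp
  also have "\<dots> \<le> (\<Sum>x\<in>S \<inter> {x. \<bar>f x\<bar> > a}. f x ^ (2 * p))"
  proof (rule sum_mono)
    fix x assume "x \<in> S \<inter> {x. \<bar>f x\<bar> > a}"
    then have "a ^ (2 * p) \<le> \<bar>f x\<bar> ^ (2 * p)" using assms(3) by (intro power_mono) auto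
    then show "a ^ (2 * p) \<le> f x ^ (2 * p)" by (simp add: power_even_abs)
  qed
  also have "\<dots> \<le> (\<Sum>x\<in>S. f x ^ (2 * p))"
    using assms(1) by (intro sum_mono2) auto
  finally have "real (card (S \<inter> {x. \<bar>f x\<bar> > a})) \<le> (\<Sum>x\<in>S. f x ^ (2 * p)) / a ^ (2 * p)"
    using assms(3) by (simp add: field_simps)
  then have "real (card (S \<inter> {x. \<bar>f x\<bar> > a})) / real (card S) \<le> (\<Sum>x\<in>S. f x ^ (2 * p)) / a ^ (2 * p) / real (card S)"
    by (intro divide_right_mono) auto
  then show ?thesis
    using assms by (simp add: measure_pmf_of_set mean_over_def mult.commute)
qed

text \<open>In terms of \<open>T\<close> the moment bound is \<open>(32 * p / T) ^ (p * r)\<close>.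
  Taking \<open>p\<close> as \<open>T / (32 * exp 1)\<close> rounded down makes the base at most
  \<open>exp (- 1)\<close>; the rounding costs at most a factor \<open>exp 1\<close>.\<close>

lemma tail_from_moments:
  fixes P a m d :: real
  assumes "0 < a" "0 < m" "0 < d" "0 < r" "P \<le> 1"
    and mom: "\<And>p::nat. 0 < p \<Longrightarrow> P \<le> (32 * real p * m) ^ (p * r) * d ^ (2 * p) / a ^ (2 * p)"
  shows "P \<le> exp 1 * exp (- (1 / (32 * exp 1) * a powr (2 / real r)) / (m * d powr (2 / real r)))"
proof -
  define T where "T = a powr (2 / real r) / (m * d powr (2 / real r))"
  define t where "t = T / (32 * exp 1)"
  define p where "p = nat \<lfloor>t\<rfloor>"
  have T0: "0 < T" using assms by (simp add: T_def)
  then have t0: "0 < t" by (simp add: t_def)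
  have "P \<le> exp 1 * exp (- t)"
  \<comment> \<open>For \<open>t < 1\<close> no moment is used: the right side already exceeds
    1.\<close>
  proof (cases "p = 0")
    case True
    then have "t < 1" using t0 by (simp add: p_def)
    then have "1 \<le> exp 1 * exp (- t)" by (simp flip: exp_add)
    then show ?thesis using assms(5) by linarith
  next
    case False
    have pt: "real p \<le> t" "t < real p + 1"
      using t0 by (simp_all add: p_def)
    have "T * m = (a / d) powr (2 / real r)"
      using assms by (simp add: T_def powr_divide)
    then have "(T * m) ^ r = (a / d) powr (2 / real r * real r)"
      using assms by (simp add: powr_power)
    also have "\<dots> = (a / d)\<^sup>2"
      using assms by (simp flip: powr_numeral)
    finally have Tm: "a\<^sup>2 = (T * m) ^ r * d\<^sup>2"
      using assms by (simp add: power_divide)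
    have "(32 * real p * m) ^ (p * r) * d ^ (2 * p) / a ^ (2 * p) = ((32 * real p * m) ^ r * d\<^sup>2 / a\<^sup>2) ^ p"
      by (simp add: power_mult power_divide power_mult_distrib mult.commute[of p r])
    also have "(32 * real p * m) ^ r * d\<^sup>2 / a\<^sup>2 = (32 * real p / T) ^ r"
      using assms T0 unfolding Tm by (simp add: power_divide power_mult_distrib)
    also have "((32 * real p / T) ^ r) ^ p \<le> (exp (- 1) ^ r) ^ p"
    proof (intro power_mono)
      show "32 * real p / T \<le> exp (- 1)"
        using pt T0 by (simp add: t_def exp_minus field_simps)
    qed (use T0 in auto)
    also have "\<dots> \<le> (exp (- 1) ^ 1) ^ p"
      using assms(4) by (intro power_mono power_decreasing) auto
    also have "\<dots> = exp (- real p)"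
      by (simp flip: exp_of_nat_mult)
    also have "\<dots> \<le> exp 1 * exp (- t)"
      using pt by (simp flip: exp_add)
    finally show ?thesis using mom[of p] False by simp
  qed
  then show ?thesis by (simp add: t_def T_def mult_ac)
qed

theorem theorem1p1:
  fixes k :: nat
  shows "\<exists>C c :: real. C > 0 \<and> c > 0 \<and>
    (\<forall>(r::nat) (N::nat) (H::nat set set) (m::nat) (a::real).
       1 \<le> r \<longrightarrow> r \<le> k \<longrightarrow>
       uniform_hypergraph k N H \<longrightarrow> tuple_regular (r - 1) N H \<longrightarrow>
       1 \<le> m \<longrightarrow> m \<le> N \<longrightarrow> a > 0 \<longrightarrow>
       measure_pmf.prob (random_subset N m) {B. \<bar>edge_deviation N H m B\<bar> > a}
         \<le> real N powr C *
            exp (- (c * a powr (2 / real r)) /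
                 (real m * real (max_degree r N H) powr (2 / real r))))"
\<comment> \<open>The value of \<open>c\<close> comes from \<open>tail_from_moments\<close>. With
  \<open>C = 2\<close> the factor \<open>exp 1\<close> is absorbed for \<open>N \<ge> 2\<close>,
  since \<open>exp 1 \<le> 3 < 4 \<le> N\<^sup>2\<close>.\<close>
proof (rule exI[of _ 2], rule exI[of _ "1 / (32 * exp 1)"], intro conjI allI impI)
  fix r N :: nat and H :: "nat set set" and m :: nat and a :: real
  assume r: "1 \<le> r" "r \<le> k" and H: "uniform_hypergraph k N H" "tuple_regular (r - 1) N H"
    and m: "1 \<le> m" "m \<le> N" and a: "0 < a"
  define V where "V = {1..N}"
  define S where "S = nsets V m"
  define \<Delta> where "\<Delta> = max_degree r N H"
  define P where "P = measure_pmf.prob (random_subset N m) {B. \<bar>edge_deviation N H m B\<bar> > a}"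
  have V: "finite V" "card V = N" by (auto simp: V_def)
  have S: "finite S" "S \<noteq> {}"
    using V m by (auto simp: S_def finite_imp_finite_nsets nsets_eq_empty_iff)
  have dev: "edge_deviation N H m B = real (edge_count H B) - mean_over S (\<lambda>B. real (edge_count H B))" for B
    using S by (simp add: edge_deviation_def mean_edge_count_def random_subset_def integral_pmf_of_set
        mean_over_def S_def V_def)
  have Pmean: "P \<le> mean_over S (\<lambda>B. edge_deviation N H m B ^ (2 * p)) / a ^ (2 * p)" for p
    using prob_abs_gt_le_moment[OF S a] by (simp add: P_def random_subset_def S_def V_def)
  have H': "H \<subseteq> nsets V k"
    using H(1) by (simp add: uniform_hypergraph_def V_def)
  have reg: "regular_on V (r - 1) H"
    using H(2) unfolding tuple_regular_def regular_on_def V_def .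
  have deg: "set_degree H e \<le> \<Delta>" if "e \<in> nsets V r" for e
    unfolding \<Delta>_def max_degree_def using that V
    by (intro Max_ge) (auto simp: V_def finite_imp_finite_nsets)
  have mom: "P \<le> (32 * real p * real m) ^ (p * r) * real \<Delta> ^ (2 * p) / a ^ (2 * p)" if "0 < p" for p
  proof -
    have "mean_over S (\<lambda>B. edge_deviation N H m B ^ (2 * p))
        \<le> (32 * real p * real m) ^ (p * Suc (r - 1)) * real \<Delta> ^ (2 * p)"
      unfolding dev S_def
      by (rule edge_count_moment[OF V(1) H' _ reg]) (use V(2) r m deg that in auto)
    then show ?thesis
      using Pmean[of p] a r by (auto intro!: order_trans[OF Pmean] divide_right_mono)
  qed
  have "P \<le> real N powr 2 * exp (- (1 / (32 * exp 1) * a powr (2 / real r)) / (real m * real \<Delta> powr (2 / real r)))"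
  \<comment> \<open>Here \<open>N\<^sup>2 = 1\<close> cannot absorb \<open>exp 1\<close>, but
    \<open>V\<close> is the only \<open>m\<close>-set and the deviation vanishes.\<close>
  proof (cases "N = 1")
    case True
    then have "S = {V}" using m V by (auto simp: S_def V_def nsets_singleton_iff)
    then have "mean_over S (\<lambda>B. edge_deviation N H m B ^ (2 * 1)) = 0"
      unfolding dev by (simp add: mean_over_def)
    then have "P \<le> 0" using Pmean[of 1] by simp
    then show ?thesis by (rule order_trans) simp
  next
    case False
    then have "2 \<le> real N" using m by simp
    then have "2\<^sup>2 \<le> (real N)\<^sup>2" by (intro power_mono) auto
    then have N: "exp 1 \<le> real N powr 2" "1 \<le> real N powr 2"
      using exp_le m by (simp_all add: powr_numeral)
    have P1: "P \<le> 1" by (simp add: P_def)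
    show ?thesis
    \<comment> \<open>Division by zero yields 0, so for \<Delta> = 0 the exponential is 1 and the
      right side is at least 1.\<close>
    proof (cases "\<Delta> = 0")
      case True
      then show ?thesis using P1 N by simp
    next
      case False
      have "P \<le> exp 1 * exp (- (1 / (32 * exp 1) * a powr (2 / real r)) / (real m * real \<Delta> powr (2 / real r)))"
        by (rule tail_from_moments) (use a m r False P1 mom in auto)
      also have "\<dots> \<le> real N powr 2 * exp (- (1 / (32 * exp 1) * a powr (2 / real r)) / (real m * real \<Delta> powr (2 / real r)))"
        using N by (intro mult_right_mono) auto
      finally show ?thesis .
    qed
  qed
  then show "measure_pmf.prob (random_subset N m) {B. \<bar>edge_deviation N H m B\<bar> > a}
      \<le> real N powr 2 * exp (- (1 / (32 * exp 1) * a powr (2 / real r)) /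
          (real m * real (max_degree r N H) powr (2 / real r)))"
    by (simp only: P_def \<Delta>_def)
qed auto

end
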